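(* Let $E$ be an arbitrary directed graph and let $a\in F_E^\Gamma$. The following conditions are equivalent. (1) The element $a$ is aperiodic. (2) The element $a$ is comparable and not periodic. (3) There is a stationary element $b$ such that $a\to b$ and at least one of the core cycles of $b$ has an exit.
   Context: Setup. $\Gamma=\{x^n\mid n\in\mathbb Z\}$ is the infinite cyclic group generated by $x$. $E$ is an arbitrary directed graph with vertex set $E^0$, edge set $E^1$, source map $\mathbf s$ and range map $\mathbf r$. A vertex $v$ is a sink if $\mathbf s^{-1}(v)=\emptyset$, regular if $\mathbf s^{-1}(v)$ is finite and nonempty, and an infinite emitter if $\mathbf s^{-1}(v)$ is infinite. For every infinite emitter $v$ and every finite nonempty $Z\subseteq \mathbf s^{-1}(v)$ introduce a symbol $q_Z=q_Z^v$, called an improper vertex; elements of $E^0$ are called proper vertices. $F_E^\Gamma$ is the free commutative $\Gamma$-monoid on all proper and improper vertices (these are called the generators): its elements are finite formal sums of monomials $x^m g$ ($m\in\mathbb Z$, $g$ a generator), and $x^n$ acts by $x^n(x^m g)=x^{n+m}g$. The support of an element is the set of generators occurring in it. The relation $\to_1$ on $F_E^\Gamma-\{0\}$ is given, for all $a\in F_E^\Gamma$ and $m\in\mathbb Z$, by: (A1) $a+x^m v\to_1 a+\sum_{e\in \mathbf s^{-1}(v)}x^{m+1}\mathbf r(e)$ for $v$ regular; (A2) $a+x^m v\to_1 a+x^m q_Z+\sum_{e\in Z}x^{m+1}\mathbf r(e)$ for $v$ an infinite emitter and $Z\subseteq \mathbf s^{-1}(v)$ finite and nonempty; (A3) $a+x^m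 q_Z\to_1 a+x^m q_W+\sum_{e\in W-Z}x^{m+1}\mathbf r(e)$ for $v$ an infinite emitter and finite nonempty $Z\subsetneq W\subseteq \mathbf s^{-1}(v)$. The relation $\to$ is the reflexive and transitive closure of $\to_1$ on $F_E^\Gamma$, and $\sim$ is the congruence on $F_E^\Gamma$ generated by $\to$. For $a,b\in F_E^\Gamma$, $a\precsim b$ (also $b\succsim a$) means that $a+c\sim b$ for some $c\in F_E^\Gamma$; $a\prec b$ (also $b\succ a$) means $a\precsim b$ and not $a\sim b$. An element $a$ is comparable if $a\succsim x^n a$ for some positive integer $n$; periodic if $a\sim x^n a$ for some positive integer $n$; aperiodic if $a\succ x^n a$ for some positive integer $n$. An element $a\in F_E^\Gamma-\{0\}$ is stationary if $a\to x^n a+b$ for some positive integer $n$ and some $b\in F_E^\Gamma$. A cycle is a closed path $e_1\cdots e_n$, $n\geq 1$, with $\mathbf s(e_i)\neq \mathbf s(e_j)$ for $i\ne j$. A cycle has an exit if some vertex on it emits an edge which is not on the cycle. A cycle contains a proper vertex $v$ if $v$ is a vertex of the cycle; it contains an improper vertex $q^v_Z$ if $v$ is a vertex of the cycle and the edge of the cycle with source $v$ is not in $Z$. The core cycles of a stationary element $b$ are the cycles which contain a generator from the support of $b$. *)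

theory Defs
  imports "Graph_Theory.Graph_Theory" "HOL-Library.Multiset"
begin

text \<open>
  A directed graph is a \<^locale>\<open>wf_digraph\<close>: vertex and edge sets of any cardinality, loops and
  parallel edges allowed, with source map \<^term>\<open>tail G\<close> and range map \<^term>\<open>head G\<close>.
  The set of edges emitted by \<^term>\<open>v\<close> is \<^term>\<open>out_arcs G v\<close>.
\<close>

definition regular_vertex :: "('v, 'e) pre_digraph \<Rightarrow> 'v \<Rightarrow> bool" where
  "regular_vertex G v \<longleftrightarrow> v \<in> verts G \<and> finite (out_arcs G v) \<and> out_arcs G v \<noteq> {}"

definition infinite_emitter :: "('v, 'e) pre_digraph \<Rightarrow> 'v \<Rightarrow> bool" where
  "infinite_emitter G v \<longleftrightarrow> v \<in> verts G \<and> infinite (out_arcs G v)"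

datatype ('v, 'e) generator = Proper 'v | Improper 'v "'e set"

definition generators :: "('v, 'e) pre_digraph \<Rightarrow> ('v, 'e) generator set" where
  "generators G = Proper ` verts G \<union>
     {Improper v Z | v Z. infinite_emitter G v \<and> finite Z \<and> Z \<noteq> {} \<and> Z \<subseteq> out_arcs G v}"

text \<open>
  The infinite cyclic group generated by \<open>x\<close> is identified with the additive group of integers, and
  the monomial \<open>x\<^sup>m g\<close> with the pair \<open>(m, g)\<close>. The free commutative monoid with an action of this
  group is thus the monoid of finite multisets of such pairs.
\<close>

type_synonym ('v, 'e) elt = "(int \<times> ('v, 'e) generator) multiset"

definition free_monoid :: "('v, 'e) pre_digraph \<Rightarrow> ('v, 'e) elt set" where
  "free_monoid G = {a. snd ` set_mset a \<subseteq> generators G}"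

abbreviation monom :: "int \<Rightarrow> ('v, 'e) generator \<Rightarrow> ('v, 'e) elt" where
  "monom m g \<equiv> {#(m, g)#}"

definition act :: "int \<Rightarrow> ('v, 'e) elt \<Rightarrow> ('v, 'e) elt" where
  "act n a = image_mset (\<lambda>(m, g). (n + m, g)) a"

definition support :: "('v, 'e) elt \<Rightarrow> ('v, 'e) generator set" where
  "support a = snd ` set_mset a"

inductive step :: "('v, 'e) pre_digraph \<Rightarrow> ('v, 'e) elt \<Rightarrow> ('v, 'e) elt \<Rightarrow> bool"
  for G :: "('v, 'e) pre_digraph"
where
  A1: "a \<in> free_monoid G \<Longrightarrow> regular_vertex G v \<Longrightarrow>
    step G (a + monom m (Proper v))
           (a + (\<Sum>e\<in>out_arcs G v. monom (m + 1) (Proper (head G e))))"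
| A2: "a \<in> free_monoid G \<Longrightarrow> infinite_emitter G v \<Longrightarrow>
    finite Z \<Longrightarrow> Z \<noteq> {} \<Longrightarrow> Z \<subseteq> out_arcs G v \<Longrightarrow>
    step G (a + monom m (Proper v))
           (a + monom m (Improper v Z) + (\<Sum>e\<in>Z. monom (m + 1) (Proper (head G e))))"
| A3: "a \<in> free_monoid G \<Longrightarrow> infinite_emitter G v \<Longrightarrow>
    finite W \<Longrightarrow> Z \<noteq> {} \<Longrightarrow> Z \<subset> W \<Longrightarrow> W \<subseteq> out_arcs G v \<Longrightarrow>
    step G (a + monom m (Improper v Z))
           (a + monom m (Improper v W) + (\<Sum>e\<in>W - Z. monom (m + 1) (Proper (head G e))))"

definition arrow :: "('v, 'e) pre_digraph \<Rightarrow> ('v, 'e) elt \<Rightarrow> ('v, 'e) elt \<Rightarrow> bool" where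
  "arrow G a b \<longleftrightarrow> a \<in> free_monoid G \<and> b \<in> free_monoid G \<and> (step G)\<^sup>*\<^sup>* a b"

inductive cong :: "('v, 'e) pre_digraph \<Rightarrow> ('v, 'e) elt \<Rightarrow> ('v, 'e) elt \<Rightarrow> bool"
  for G :: "('v, 'e) pre_digraph"
where
  base: "arrow G a b \<Longrightarrow> cong G a b"
| refl: "a \<in> free_monoid G \<Longrightarrow> cong G a a"
| sym: "cong G a b \<Longrightarrow> cong G b a"
| trans: "cong G a b \<Longrightarrow> cong G b c \<Longrightarrow> cong G a c"
| add: "cong G a b \<Longrightarrow> c \<in> free_monoid G \<Longrightarrow> cong G (a + c) (b + c)"
| act: "cong G a b \<Longrightarrow> cong G (act n a) (act n b)"

definition precsim :: "('v, 'e) pre_digraph \<Rightarrow> ('v, 'e) elt \<Rightarrow> ('v, 'e) elt \<Rightarrow> bool" where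
  "precsim G a b \<longleftrightarrow> (\<exists>c\<in>free_monoid G. cong G (a + c) b)"

definition prec :: "('v, 'e) pre_digraph \<Rightarrow> ('v, 'e) elt \<Rightarrow> ('v, 'e) elt \<Rightarrow> bool" where
  "prec G a b \<longleftrightarrow> precsim G a b \<and> \<not> cong G a b"

definition comparable :: "('v, 'e) pre_digraph \<Rightarrow> ('v, 'e) elt \<Rightarrow> bool" where
  "comparable G a \<longleftrightarrow> (\<exists>n>0. precsim G (act n a) a)"

definition periodic :: "('v, 'e) pre_digraph \<Rightarrow> ('v, 'e) elt \<Rightarrow> bool" where
  "periodic G a \<longleftrightarrow> (\<exists>n>0. cong G a (act n a))"

definition aperiodic :: "('v, 'e) pre_digraph \<Rightarrow> ('v, 'e) elt \<Rightarrow> bool" where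
  "aperiodic G a \<longleftrightarrow> (\<exists>n>0. prec G (act n a) a)"

definition stationary :: "('v, 'e) pre_digraph \<Rightarrow> ('v, 'e) elt \<Rightarrow> bool" where
  "stationary G a \<longleftrightarrow> a \<in> free_monoid G \<and> a \<noteq> {#} \<and>
     (\<exists>n>0. \<exists>b\<in>free_monoid G. arrow G a (act n a + b))"

text \<open>
  Cycles are those of the library, \<^const>\<open>pre_digraph.cycle\<close>: nonempty lists of edges forming a
  closed walk whose vertices, the repeated base vertex counted once, are distinct; that is, the
  sources of the edges are pairwise distinct. The vertices of a cycle \<open>c\<close> are \<open>tail G ` set c\<close>.
\<close>

definition has_exit :: "('v, 'e) pre_digraph \<Rightarrow> 'e list \<Rightarrow> bool" where
  "has_exit G c \<longleftrightarrow> (\<exists>v \<in> tail G ` set c. \<exists>f \<in> out_arcs G v. f \<notin> set c)"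

fun cycle_contains :: "('v, 'e) pre_digraph \<Rightarrow> 'e list \<Rightarrow> ('v, 'e) generator \<Rightarrow> bool" where
  "cycle_contains G c (Proper v) \<longleftrightarrow> v \<in> tail G ` set c"
| "cycle_contains G c (Improper v Z) \<longleftrightarrow> (\<exists>e \<in> set c. tail G e = v \<and> e \<notin> Z)"

definition core_cycles :: "('v, 'e) pre_digraph \<Rightarrow> ('v, 'e) elt \<Rightarrow> 'e list set" where
  "core_cycles G b = {c. pre_digraph.cycle G c \<and> (\<exists>g \<in> support b. cycle_contains G c g)}"

end

theory Submission
  imports Defs
begin

text \<open>
  Every monomial of degree below \<open>N\<close> can be expanded until only degree \<open>N\<close> vertices, sinks and
  improper vertices remain, using at an infinite emitter \<open>v\<close> a prescribed finite set \<open>Z v\<close> of arcs.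
  This additive map \<open>flow\<close> satisfies \<open>a \<rightarrow> flow a\<close>, and \<open>a \<sim> b\<close> holds exactly when \<open>a\<close> and
  \<open>b\<close> have equal flows for all large \<open>N\<close> and \<open>Z\<close>. Hence the quotient monoid is cancellative and conical, its preorder is antisymmetric, and \<open>x\<^sup>n a + c \<sim> a\<close> yields some \<open>b\<close> with
  \<open>a \<rightarrow> b \<rightarrow> x\<^sup>n b + d\<close> where \<open>d = 0\<close> only if \<open>c = 0\<close>.

  It remains to compare \<open>b \<rightarrow> x\<^sup>n b + d\<close> with the core cycles of \<open>b\<close>. If none of them has an exit,
  then \<open>b\<close> consists of vertices on exitless cycles, which only ever move along their cycles, so
  \<open>d = 0\<close>. Conversely, if \<open>d = 0\<close>, then the number of monomials is constant while the degrees tend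
  to infinity, so every vertex reachable from \<open>b\<close> emits exactly one arc.
\<close>

section \<open>Expansion of elements up to a prescribed degree\<close>

definition selector :: "('v, 'e) pre_digraph \<Rightarrow> ('v \<Rightarrow> 'e set) \<Rightarrow> bool" where
  "selector G Z \<longleftrightarrow> (\<forall>v. infinite_emitter G v \<longrightarrow> finite (Z v) \<and> Z v \<noteq> {} \<and> Z v \<subseteq> out_arcs G v)"

text \<open>
  Improper vertices are enlarged to \<open>X \<union> Z v\<close> rather than \<open>Z v\<close>, so that the expansion is a
  sequence of steps even if \<open>X\<close> is not contained in \<open>Z v\<close>.
\<close>

fun expand :: "('v, 'e) pre_digraph \<Rightarrow> ('v \<Rightarrow> 'e set) \<Rightarrow> nat \<Rightarrow> int \<Rightarrow> ('v, 'e) generator \<Rightarrow> ('v, 'e) elt"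
where
  "expand G Z 0 m g = monom m g"
| "expand G Z (Suc k) m (Proper v) =
    (if regular_vertex G v then \<Sum>e\<in>out_arcs G v. expand G Z k (m + 1) (Proper (head G e))
     else if infinite_emitter G v then
       monom m (Improper v (Z v)) + (\<Sum>e\<in>Z v. expand G Z k (m + 1) (Proper (head G e)))
     else monom m (Proper v))"
| "expand G Z (Suc k) m (Improper v X) =
    monom m (Improper v (X \<union> Z v)) + (\<Sum>e\<in>Z v - X. expand G Z k (m + 1) (Proper (head G e)))"

text \<open>Along the recursive calls of \<open>expand\<close>, degree and remaining depth always
  add up to \<open>N\<close>, so expansion stops at degree \<open>N\<close>. Monomials with
  \<open>m \<ge> N\<close> get depth \<open>0\<close> and stay as they are.\<close>

definition flow :: "('v, 'e) pre_digraph \<Rightarrow> ('v \<Rightarrow> 'e set) \<Rightarrow> int \<Rightarrow> ('v, 'e) elt \<Rightarrow> ('v, 'e) elt" where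
  "flow G Z N a = (\<Sum>(m, g)\<in>#a. expand G Z (nat (N - m)) m g)"

section \<open>Additivity, shifts and iteration of flows\<close>

lemma free_monoid_empty [simp]: "{#} \<in> free_monoid G"
  by (simp add: free_monoid_def)

lemma free_monoid_plus [simp]: "a + b \<in> free_monoid G \<longleftrightarrow> a \<in> free_monoid G \<and> b \<in> free_monoid G"
  by (auto simp: free_monoid_def)

lemma free_monoid_add_mset [simp]:
  "add_mset (m, g) a \<in> free_monoid G \<longleftrightarrow> g \<in> generators G \<and> a \<in> free_monoid G"
  by (auto simp: free_monoid_def)

lemma free_monoid_sum: "(\<And>e. e \<in> A \<Longrightarrow> f e \<in> free_monoid G) \<Longrightarrow> sum f A \<in> free_monoid G"
  by (induction A rule: infinite_finite_induct) auto

lemma act_empty [simp]: "act n {#} = {#}"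
  and act_plus [simp]: "act n (a + b) = act n a + act n b"
  and act_add_mset [simp]: "act n (add_mset (m, g) a) = add_mset (n + m, g) (act n a)"
  and size_act [simp]: "size (act n a) = size a"
  by (simp_all add: act_def)

lemma act_eq_empty_iff [simp]: "act n a = {#} \<longleftrightarrow> a = {#}"
  by (simp add: act_def)

lemma act_act [simp]: "act m (act n a) = act (m + n) a"
  by (simp add: act_def multiset.map_comp comp_def case_prod_unfold add.assoc)

lemma act_0 [simp]: "act 0 a = a"
  by (simp add: act_def)

lemma act_sum: "act n (sum f A) = (\<Sum>e\<in>A. act n (f e))"
  by (induction A rule: infinite_finite_induct) auto

lemma act_in_free_monoid_iff [simp]: "act n a \<in> free_monoid G \<longleftrightarrow> a \<in> free_monoid G"
  by (force simp: free_monoid_def act_def)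

lemma flow_empty [simp]: "flow G Z N {#} = {#}"
  and flow_plus [simp]: "flow G Z N (a + b) = flow G Z N a + flow G Z N b"
  by (simp_all add: flow_def)

lemma flow_sum: "flow G Z N (sum f A) = (\<Sum>e\<in>A. flow G Z N (f e))"
  by (induction A rule: infinite_finite_induct) auto

lemma flow_add_mset:
  "flow G Z N (add_mset (m, g) a) = expand G Z (nat (N - m)) m g + flow G Z N a"
  by (simp add: flow_def)

text \<open>\<open>NO_MATCH\<close> keeps the rule from firing on a single monomial, where it would
  loop.\<close>

lemma flow_add_mset_split:
  "NO_MATCH {#} a \<Longrightarrow> flow G Z N (add_mset (m, g) a) = flow G Z N (monom m g) + flow G Z N a"
  by (simp add: flow_def)

lemma nat_diff_Suc: "m < N \<Longrightarrow> nat (N - m) = Suc (nat (N - (m + 1)))" for m N :: int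
  by linarith

lemma flow_Proper:
  assumes "m < N"
  shows "flow G Z N (monom m (Proper v)) =
    (if regular_vertex G v then \<Sum>e\<in>out_arcs G v. flow G Z N (monom (m + 1) (Proper (head G e)))
     else if infinite_emitter G v then
       monom m (Improper v (Z v)) + (\<Sum>e\<in>Z v. flow G Z N (monom (m + 1) (Proper (head G e))))
     else monom m (Proper v))"
  by (simp add: flow_add_mset nat_diff_Suc[OF assms])

lemma flow_Improper:
  assumes "m < N"
  shows "flow G Z N (monom m (Improper v X)) =
    monom m (Improper v (X \<union> Z v)) +
    (\<Sum>e\<in>Z v - X. flow G Z N (monom (m + 1) (Proper (head G e))))"
  by (simp add: flow_add_mset nat_diff_Suc[OF assms])

lemma expand_shift: "expand G Z k (n + m) g = act n (expand G Z k m g)"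
proof (induction k arbitrary: m g)
  case (Suc k)
  have *: "expand G Z k (n + m + 1) h = act n (expand G Z k (m + 1) h)" for h
    using Suc.IH[of "m + 1" h] by (simp add: add.assoc)
  show ?case
    by (cases g) (simp_all add: * act_sum)
qed simp

text \<open>The cutoff \<open>N\<close> is an absolute degree, so a shift by \<open>n\<close> moves
  it. This relates flows up to \<open>N\<close> and up to \<open>N - n\<close> when
  \<open>act n a + c\<close> is congruent to \<open>a\<close>.\<close>

lemma flow_act: "flow G Z N (act n a) = act n (flow G Z (N - n) a)"
proof (induction a)
  case (add x a)
  show ?case
    by (cases x) (simp add: flow_add_mset add.IH expand_shift diff_diff_eq[symmetric])
qed simp

text \<open>A first stage that stays within degree \<open>N\<close> is absorbed by the full
  expansion: an enlarged improper vertex already contains \<open>Z v\<close> and emits nothing more.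
  The case \<open>k = 0\<close> admits monomials beyond degree \<open>N\<close>.\<close>

lemma flow_expand:
  assumes "k = 0 \<or> m + int k \<le> N"
  shows "flow G Z N (expand G Z k m g) = flow G Z N (monom m g)"
  using assms
proof (induction k arbitrary: m g)
  case (Suc k)
  then have "m < N"
    by simp
  moreover have "flow G Z N (expand G Z k (m + 1) h) = flow G Z N (monom (m + 1) h)" for h
    using Suc by simp
  ultimately show ?case
    by (cases g)
      (simp_all add: flow_sum flow_Proper flow_Improper flow_add_mset_split Un_absorb1 Diff_eq_empty_iff[THEN iffD2])
qed simp

lemma flow_flow:
  assumes "M \<le> N"
  shows "flow G Z N (flow G Z M a) = flow G Z N a"
proof (induction a)
  case (add x a)
  obtain m g where "x = (m, g)"
    by (cases x)
  moreover have "flow G Z N (expand G Z (nat (M - m)) m g) = flow G Z N (monom m g)"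
    using assms by (intro flow_expand) linarith
  ultimately show ?case
    using add.IH by (simp add: flow_add_mset)
qed simp

text \<open>A regular vertex emits at least one arc, and all other generators leave a monomial
  behind. Hence only zero will be congruent to zero.\<close>

lemma expand_nonempty: "selector G Z \<Longrightarrow> expand G Z k m g \<noteq> {#}"
proof (induction k arbitrary: m g)
  case (Suc k)
  have "(\<Sum>e\<in>A. expand G Z k (m + 1) (Proper (head G e))) \<noteq> {#}"
    if "finite A" "e \<in> A" for A e
    using Suc that by (simp add: sum.remove)
  with Suc.prems show ?case
    by (cases g) (auto simp: regular_vertex_def simp del: in_out_arcs_conv)
qed simp

lemma flow_eq_empty_iff: "selector G Z \<Longrightarrow> flow G Z N a = {#} \<longleftrightarrow> a = {#}"
proof (induction a)
  case (add x a)
  then show ?case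
    by (cases x) (simp add: flow_add_mset expand_nonempty)
qed simp

section \<open>Eventual equality of flows as an invariant of the congruence\<close>

text \<open>Pairs of a degree and a selector are directed, so two such conditions can be met
  together; transitivity rests on this. Selectors must be allowed to grow because a step may use
  arcs outside a given one.\<close>

definition eventually_flow_eq :: "('v, 'e) pre_digraph \<Rightarrow> ('v, 'e) elt \<Rightarrow> ('v, 'e) elt \<Rightarrow> bool" where
  "eventually_flow_eq G a b \<longleftrightarrow> (\<exists>N0 Z0. selector G Z0 \<and>
     (\<forall>N\<ge>N0. \<forall>Z. selector G Z \<longrightarrow> (\<forall>v. Z0 v \<subseteq> Z v) \<longrightarrow> flow G Z N a = flow G Z N b))"

lemma selector_exists: "\<exists>Z. selector G Z"
proof -
  have "\<exists>Y. infinite_emitter G v \<longrightarrow> finite Y \<and> Y \<noteq> {} \<and> Y \<subseteq> out_arcs G v" for v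
  proof (cases "infinite_emitter G v")
    case True
    then obtain e where "e \<in> out_arcs G v"
      unfolding infinite_emitter_def by (metis equals0I finite.emptyI)
    then show ?thesis
      by (intro exI[of _ "{e}"]) auto
  qed auto
  then show ?thesis
    unfolding selector_def by metis
qed

lemma selector_extends:
  assumes "finite Y" "Y \<noteq> {}" "Y \<subseteq> out_arcs G v"
  obtains Z where "selector G Z" "Z v = Y"
proof -
  obtain Z where "selector G Z"
    using selector_exists by blast
  then have "selector G (Z(v := Y))"
    using assms by (simp add: selector_def)
  then show ?thesis
    using that by simp
qed

lemma selector_Un: "selector G Z \<Longrightarrow> selector G Z' \<Longrightarrow> selector G (\<lambda>v. Z v \<union> Z' v)"
  by (simp add: selector_def)

lemma eventually_flow_eqD2:
  assumes "eventually_flow_eq G a b" "eventually_flow_eq G c d"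
  obtains N0 Z0 where "selector G Z0"
    "\<And>N Z. N \<ge> N0 \<Longrightarrow> selector G Z \<Longrightarrow> (\<forall>v. Z0 v \<subseteq> Z v) \<Longrightarrow>
       flow G Z N a = flow G Z N b \<and> flow G Z N c = flow G Z N d"
proof -
  obtain N1 Z1 where 1: "selector G Z1"
    "\<forall>N\<ge>N1. \<forall>Z. selector G Z \<longrightarrow> (\<forall>v. Z1 v \<subseteq> Z v) \<longrightarrow> flow G Z N a = flow G Z N b"
    using assms(1) unfolding eventually_flow_eq_def by blast
  obtain N2 Z2 where 2: "selector G Z2"
    "\<forall>N\<ge>N2. \<forall>Z. selector G Z \<longrightarrow> (\<forall>v. Z2 v \<subseteq> Z v) \<longrightarrow> flow G Z N c = flow G Z N d"
    using assms(2) unfolding eventually_flow_eq_def by blast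
  show ?thesis
    by (rule that[OF selector_Un[OF 1(1) 2(1)], of "max N1 N2"]) (use 1 2 in auto)
qed

lemma eventually_flow_eq_refl: "eventually_flow_eq G a a"
  using selector_exists unfolding eventually_flow_eq_def by blast

lemma eventually_flow_eq_trans:
  assumes "eventually_flow_eq G a b" "eventually_flow_eq G b c"
  shows "eventually_flow_eq G a c"
  using eventually_flow_eqD2[OF assms] unfolding eventually_flow_eq_def by metis

text \<open>Once \<open>N\<close> exceeds the degree of the rewritten monomial and
  \<open>Z v\<close> contains the arcs chosen by the step, the step only anticipates a part of the
  expansion.\<close>

lemma step_imp_eventually_flow_eq:
  assumes "step G a b"
  shows "eventually_flow_eq G a b"
  using assms
proof cases
  case (A1 c v m)
  then have "\<forall>N\<ge>m + 1. flow G Z N a = flow G Z N b" for Z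
    by (auto simp: flow_Proper flow_add_mset_split flow_sum)
  then show ?thesis
    using selector_exists unfolding eventually_flow_eq_def by blast
next
  case (A2 c v Y m)
  obtain Z0 where Z0: "selector G Z0" "Z0 v = Y"
    using selector_extends A2 by metis
  have "flow G Z N a = flow G Z N b"
    if "N \<ge> m + 1" "selector G Z" "\<forall>u. Z0 u \<subseteq> Z u" for N Z
  proof -
    have "Y \<subseteq> Z v" "finite (Z v)"
      using that A2 Z0 by (auto simp: selector_def)
    \<comment> \<open>The step emits the arcs in \<open>Y\<close>; the improper vertex it creates
      emits those in \<open>Z v - Y\<close>.\<close>
    then have "sum f (Z v) = sum f (Z v - Y) + sum f Y" for f :: "'b \<Rightarrow> ('a, 'b) elt"
      by (rule sum.subset_diff)
    then show ?thesis
      using that A2 \<open>Y \<subseteq> Z v\<close>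
      by (simp add: flow_Proper flow_Improper flow_add_mset_split flow_sum Un_absorb1
          regular_vertex_def infinite_emitter_def)
  qed
  then show ?thesis
    using Z0(1) unfolding eventually_flow_eq_def by blast
next
  case (A3 c v W X m)
  have "W \<noteq> {}"
    using A3 by blast
  then obtain Z0 where Z0: "selector G Z0" "Z0 v = W"
    using selector_extends A3 by metis
  have "flow G Z N a = flow G Z N b"
    if "N \<ge> m + 1" "selector G Z" "\<forall>u. Z0 u \<subseteq> Z u" for N Z
  proof -
    have "W \<subseteq> Z v" "finite (Z v)"
      using that A3 Z0 by (auto simp: selector_def)
    then have "sum f (Z v - X) = sum f (Z v - X - (W - X)) + sum f (W - X)"
      for f :: "'b \<Rightarrow> ('a, 'b) elt"
      by (intro sum.subset_diff) auto
    moreover have "Z v - X - (W - X) = Z v - W" "X \<union> Z v = Z v" "W \<union> Z v = Z v"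
      using \<open>W \<subseteq> Z v\<close> A3 by auto
    ultimately show ?thesis
      using that A3
      by (simp add: flow_Improper flow_add_mset_split flow_sum)
  qed
  then show ?thesis
    using Z0(1) unfolding eventually_flow_eq_def by blast
qed

lemma cong_imp_eventually_flow_eq: "cong G a b \<Longrightarrow> eventually_flow_eq G a b"
proof (induction rule: cong.induct)
  case (base a b)
  then have "(step G)\<^sup>*\<^sup>* a b"
    by (simp add: arrow_def)
  then show ?case
    by induction (blast intro: eventually_flow_eq_refl eventually_flow_eq_trans
        step_imp_eventually_flow_eq)+
next
  case (sym a b)
  then show ?case
    unfolding eventually_flow_eq_def by metis
next
  case (add a b c)
  then show ?case
    unfolding eventually_flow_eq_def flow_plus by metis
next
  case (act a b n)
  then obtain N0 Z0 where *: "selector G Z0"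
    "\<And>N Z. N \<ge> N0 \<Longrightarrow> selector G Z \<Longrightarrow> (\<forall>v. Z0 v \<subseteq> Z v) \<Longrightarrow> flow G Z N a = flow G Z N b"
    unfolding eventually_flow_eq_def by blast
  show ?case
    unfolding eventually_flow_eq_def flow_act
    by (intro exI[of _ "N0 + n"] exI[of _ Z0]) (auto simp: * intro!: arg_cong[of _ _ "act n"])
qed (blast intro: eventually_flow_eq_refl eventually_flow_eq_trans)+

section \<open>Steps on a single monomial, and arrows under shifts and sums\<close>

text \<open>Removing the context \<open>a\<close> from the three rules allows shifting, splitting
  and counting to be checked on one monomial.\<close>

inductive monom_step :: "('v, 'e) pre_digraph \<Rightarrow> int \<times> ('v, 'e) generator \<Rightarrow> ('v, 'e) elt \<Rightarrow> bool"
  for G :: "('v, 'e) pre_digraph"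
where
  regular: "regular_vertex G v \<Longrightarrow>
    monom_step G (m, Proper v) (\<Sum>e\<in>out_arcs G v. monom (m + 1) (Proper (head G e)))"
| infinite: "infinite_emitter G v \<Longrightarrow> finite Z \<Longrightarrow> Z \<noteq> {} \<Longrightarrow> Z \<subseteq> out_arcs G v \<Longrightarrow>
    monom_step G (m, Proper v)
      (monom m (Improper v Z) + (\<Sum>e\<in>Z. monom (m + 1) (Proper (head G e))))"
| improper: "infinite_emitter G v \<Longrightarrow> finite W \<Longrightarrow> Z \<noteq> {} \<Longrightarrow> Z \<subset> W \<Longrightarrow> W \<subseteq> out_arcs G v \<Longrightarrow>
    monom_step G (m, Improper v Z)
      (monom m (Improper v W) + (\<Sum>e\<in>W - Z. monom (m + 1) (Proper (head G e))))"

lemma step_iff_monom_step: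
  "step G a b \<longleftrightarrow> (\<exists>c x r. c \<in> free_monoid G \<and> monom_step G x r \<and> a = c + {#x#} \<and> b = c + r)"
proof
  assume "step G a b"
  then show "\<exists>c x r. c \<in> free_monoid G \<and> monom_step G x r \<and> a = c + {#x#} \<and> b = c + r"
  proof cases
    case (A1 c v m)
    show ?thesis
      by (rule exI[of _ c], rule exI[of _ "(m, Proper v)"])
        (use A1 monom_step.regular[of G v m] in \<open>auto simp: add.assoc\<close>)
  next
    case (A2 c v Z m)
    show ?thesis
      by (rule exI[of _ c], rule exI[of _ "(m, Proper v)"])
        (use A2 monom_step.infinite[of G v Z m] in \<open>auto simp: add.assoc\<close>)
  next
    case (A3 c v W Z m)
    show ?thesis
      by (rule exI[of _ c], rule exI[of _ "(m, Improper v Z)"])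
        (use A3 monom_step.improper[of G v W Z m] in \<open>auto simp: add.assoc\<close>)
  qed
next
  assume "\<exists>c x r. c \<in> free_monoid G \<and> monom_step G x r \<and> a = c + {#x#} \<and> b = c + r"
  then obtain c x r where c: "c \<in> free_monoid G" "a = c + {#x#}" "b = c + r"
    and "monom_step G x r"
    by blast
  from this(4) show "step G a b"
  proof cases
    case (regular v m)
    then show ?thesis
      using c step.A1[of c G v m] by simp
  next
    case (infinite v Z m)
    then show ?thesis
      using c step.A2[of c G v Z m] by (simp add: add.assoc)
  next
    case (improper v W Z m)
    then show ?thesis
      using c step.A3[of c G v W Z m] by (simp add: add.assoc)
  qed
qed

lemma size_sum_monom: "finite A \<Longrightarrow> size (\<Sum>e\<in>A. {#f e#}) = card A"
  by (induction A rule: finite_induct) auto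

lemma set_mset_sum: "finite A \<Longrightarrow> set_mset (sum f A) = (\<Union>e\<in>A. set_mset (f e))"
  by (induction A rule: finite_induct) auto

lemma size_monom_step: "monom_step G x r \<Longrightarrow> 1 \<le> size r"
  by (erule monom_step.cases) (auto simp: regular_vertex_def size_sum_monom card_gt_0_iff Suc_le_eq)

lemma size_step: "step G a b \<Longrightarrow> size a \<le> size b"
  using size_monom_step by (fastforce simp: step_iff_monom_step)

lemma size_steps: "(step G)\<^sup>*\<^sup>* a b \<Longrightarrow> size a \<le> size b"
  by (induction rule: rtranclp_induct) (auto dest: size_step)

lemma size_arrow: "arrow G a b \<Longrightarrow> size a \<le> size b"
  unfolding arrow_def using size_steps by blast

lemma rtranclp_map:
  assumes "r\<^sup>*\<^sup>* a b" "\<And>a b. r a b \<Longrightarrow> r (f a) (f b)"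
  shows "r\<^sup>*\<^sup>* (f a) (f b)"
  using assms(1) by induction (auto intro: assms(2) rtranclp.rtrancl_into_rtrancl)

lemma act_sum_monom:
  "act n (\<Sum>e\<in>A. monom (m + 1) (h e)) = (\<Sum>e\<in>A. monom (n + m + 1) (h e))"
  by (simp add: act_sum add.assoc)

lemma monom_step_act:
  assumes "monom_step G (m, g) r"
  shows "monom_step G (n + m, g) (act n r)"
  using assms
proof cases
  case (regular v)
  then show ?thesis
    using monom_step.regular[of G v "n + m"] by (simp add: act_sum_monom)
next
  case (infinite v Z)
  then show ?thesis
    using monom_step.infinite[of G v Z "n + m"] by (simp add: act_sum_monom)
next
  case (improper v W Z)
  then show ?thesis
    using monom_step.improper[of G v W Z "n + m"] by (simp add: act_sum_monom)
qed

lemma step_act: "step G a b \<Longrightarrow> step G (act n a) (act n b)"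
proof -
  assume "step G a b"
  then obtain c m g r where "c \<in> free_monoid G" "monom_step G (m, g) r"
    "a = c + {#(m, g)#}" "b = c + r"
    unfolding step_iff_monom_step by auto
  then show ?thesis
    unfolding step_iff_monom_step
    by (intro exI[of _ "act n c"] exI[of _ "(n + m, g)"] exI[of _ "act n r"])
      (simp add: monom_step_act)
qed

lemma arrow_act: "arrow G a b \<Longrightarrow> arrow G (act n a) (act n b)"
  unfolding arrow_def by (simp add: rtranclp_map[where f = "act n"] step_act)

lemma arrow_refl: "a \<in> free_monoid G \<Longrightarrow> arrow G a a"
  by (simp add: arrow_def)

lemma arrow_from_empty:
  assumes "arrow G {#} d"
  shows "d = {#}"
proof -
  have "(step G)\<^sup>*\<^sup>* {#} d"
    using assms by (simp add: arrow_def)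
  then show ?thesis
    by (cases rule: converse_rtranclpE) (auto simp: step_iff_monom_step)
qed

lemma arrow_trans [trans]: "arrow G a b \<Longrightarrow> arrow G b c \<Longrightarrow> arrow G a c"
  unfolding arrow_def by auto

lemma arrow_add_right:
  assumes "arrow G a b" "c \<in> free_monoid G"
  shows "arrow G (a + c) (b + c)"
proof -
  have "step G (d + c) (d' + c)" if d: "step G d d'" for d d'
  proof -
    obtain c' x r where "c' \<in> free_monoid G" "monom_step G x r" "d = c' + {#x#}" "d' = c' + r"
      using d unfolding step_iff_monom_step by blast
    then show ?thesis
      unfolding step_iff_monom_step using assms(2)
      by (intro exI[of _ "c' + c"] exI[of _ x] exI[of _ r]) simp
  qed
  then have "(step G)\<^sup>*\<^sup>* (a + c) (b + c)"
    using assms(1) unfolding arrow_def by (intro rtranclp_map[where f = "\<lambda>d. d + c"]) auto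
  then show ?thesis
    using assms by (simp add: arrow_def)
qed

lemma arrow_add: "arrow G a b \<Longrightarrow> arrow G c d \<Longrightarrow> arrow G (a + c) (b + d)"
  using arrow_add_right[of G a b c] arrow_add_right[of G c d b] arrow_trans
  by (metis add.commute arrow_def)

lemma arrow_sum:
  "(\<And>e. e \<in> A \<Longrightarrow> arrow G (f e) (h e)) \<Longrightarrow> arrow G (sum f A) (sum h A)"
  by (induction A rule: infinite_finite_induct) (auto intro: arrow_add arrow_refl)

text \<open>The rewritten monomial lies in one of the two summands, and the other summand stays
  fixed.\<close>

lemma step_split:
  assumes "step G (a + b) d"
  shows "(\<exists>a'. step G a a' \<and> d = a' + b) \<or> (\<exists>b'. step G b b' \<and> d = a + b')"
proof -
  obtain c x r where c: "c \<in> free_monoid G" "monom_step G x r" "a + b = c + {#x#}" "d = c + r"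
    using assms unfolding step_iff_monom_step by blast
  then have "x \<in># a + b"
    by simp
  then consider "x \<in># a" | "x \<in># b"
    by auto
  then show ?thesis
  proof cases
    case 1
    then obtain a' where a: "a = a' + {#x#}"
      by (metis insert_DiffM2)
    then have "c = a' + b"
      using c(3) by simp
    then have "step G a (a' + r)"
      using c(1,2) a step_iff_monom_step by (metis free_monoid_plus)
    then show ?thesis
      using c \<open>c = a' + b\<close> by (auto simp: algebra_simps)
  next
    case 2
    then obtain b' where b: "b = b' + {#x#}"
      by (metis insert_DiffM2)
    then have "c = a + b'"
      using c(3) by simp
    then have "step G b (b' + r)"
      using c(1,2) b step_iff_monom_step by (metis free_monoid_plus)
    then show ?thesis
      using c \<open>c = a + b'\<close> by (auto simp: algebra_simps)
  qed
qed

lemma arrow_split: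
  assumes "arrow G (a + b) d"
  obtains a' b' where "d = a' + b'" "arrow G a a'" "arrow G b b'"
proof -
  have "(step G)\<^sup>*\<^sup>* (a + b) d"
    using assms by (simp add: arrow_def)
  then have "\<exists>a' b'. d = a' + b' \<and> (step G)\<^sup>*\<^sup>* a a' \<and> (step G)\<^sup>*\<^sup>* b b'"
  proof induction
    case (step d d')
    then show ?case
      by (metis rtranclp.rtrancl_into_rtrancl step_split)
  qed blast
  then show ?thesis
    using assms that by (auto simp: arrow_def)
qed

lemma cong_in_free_monoid: "cong G a b \<Longrightarrow> a \<in> free_monoid G \<and> b \<in> free_monoid G"
  by (induction rule: cong.induct) (auto simp: arrow_def)

section \<open>Arrows to the flow, and cancellation\<close>

context wf_digraph
begin

lemma monom_step_in_free_monoid: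
  assumes "monom_step G x r"
  shows "{#x#} \<in> free_monoid G \<and> r \<in> free_monoid G"
proof -
  have sum: "(\<Sum>e\<in>A. monom m (Proper (head G e))) \<in> free_monoid G"
    if "A \<subseteq> out_arcs G v" for A m v
    using that by (intro free_monoid_sum) (auto simp: generators_def)
  from assms show ?thesis
  proof cases
    case (regular v m)
    then show ?thesis
      using sum[of "out_arcs G v" v] by (auto simp: generators_def regular_vertex_def)
  next
    case (infinite v Z m)
    then show ?thesis
      using sum[of Z v] by (auto simp: generators_def infinite_emitter_def)
  next
    case (improper v W Z m)
    then show ?thesis
      using sum[of "W - Z" v] by (auto simp: generators_def intro: finite_subset)
  qed
qed

lemma step_in_free_monoid: "step G a b \<Longrightarrow> a \<in> free_monoid G \<and> b \<in> free_monoid G"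
  using monom_step_in_free_monoid unfolding step_iff_monom_step by fastforce

lemma monom_step_imp_arrow: "monom_step G x r \<Longrightarrow> arrow G {#x#} r"
  using monom_step_in_free_monoid[of x r] unfolding arrow_def
  by (intro conjI r_into_rtranclp) (simp_all add: step_iff_monom_step exI[of _ "{#}"] del: split_paired_Ex)

lemma arrow_expand:
  assumes "selector G Z" "g \<in> generators G"
  shows "arrow G (monom m g) (expand G Z k m g)"
  using assms(2)
proof (induction k arbitrary: m g)
  case 0
  then show ?case
    by (simp add: arrow_refl)
next
  case (Suc k)
  have sum: "arrow G (\<Sum>e\<in>A. monom (m + 1) (Proper (head G e)))
      (\<Sum>e\<in>A. expand G Z k (m + 1) (Proper (head G e)))" if "A \<subseteq> arcs G" for A
    using that by (intro arrow_sum Suc.IH) (auto simp: generators_def)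
  have sum': "arrow G (monom m h + (\<Sum>e\<in>A. monom (m + 1) (Proper (head G e))))
      (monom m h + (\<Sum>e\<in>A. expand G Z k (m + 1) (Proper (head G e))))"
    if "A \<subseteq> arcs G" "h \<in> generators G" for A h
    by (intro arrow_add sum that arrow_refl) (simp add: that)
  show ?case
  proof (cases g)
    case (Proper v)
    consider "regular_vertex G v" | "infinite_emitter G v" "\<not> regular_vertex G v"
      | "\<not> infinite_emitter G v" "\<not> regular_vertex G v"
      by blast
    then show ?thesis
    proof cases
      case 1
      have "out_arcs G v \<subseteq> arcs G"
        by auto
      from arrow_trans[OF monom_step_imp_arrow[OF monom_step.regular[OF 1]] sum[OF this]]
      show ?thesis
        using 1 Proper by simp
    next
      case 2
      then have Z: "finite (Z v)" "Z v \<noteq> {}" "Z v \<subseteq> out_arcs G v"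
        using assms(1) by (auto simp: selector_def)
      then have "Z v \<subseteq> arcs G" "Improper v (Z v) \<in> generators G"
        using 2 by (auto simp: generators_def)
      from arrow_trans[OF monom_step_imp_arrow[OF monom_step.infinite[OF 2(1) Z]] sum'[OF this]]
      show ?thesis
        using 2 Proper by simp
    next
      case 3
      then show ?thesis
        using Proper Suc.prems by (simp add: arrow_refl)
    qed
  next
    case (Improper v X)
    then have X: "infinite_emitter G v" "finite X" "X \<noteq> {}" "X \<subseteq> out_arcs G v"
      using Suc.prems by (auto simp: generators_def)
    then have Z: "finite (Z v)" "Z v \<noteq> {}" "Z v \<subseteq> out_arcs G v"
      using assms(1) by (auto simp: selector_def)
    show ?thesis
    proof (cases "Z v \<subseteq> X")
      \<comment> \<open>Rule \<open>A3\<close> needs a strictly larger arc set, so this case takes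
        the empty sequence of steps.\<close>
      case True
      then have "expand G Z (Suc k) m g = monom m g"
        by (simp add: Improper Un_absorb2 Diff_eq_empty_iff[THEN iffD2])
      then show ?thesis
        using Suc.prems by (simp add: arrow_refl)
    next
      case False
      have "monom_step G (m, Improper v X) (monom m (Improper v (X \<union> Z v)) +
          (\<Sum>e\<in>X \<union> Z v - X. monom (m + 1) (Proper (head G e))))"
        using X Z False by (intro monom_step.improper) auto
      moreover have "X \<union> Z v - X = Z v - X"
        by auto
      ultimately have "arrow G (monom m (Improper v X)) (monom m (Improper v (X \<union> Z v)) +
          (\<Sum>e\<in>Z v - X. monom (m + 1) (Proper (head G e))))"
        by (auto dest: monom_step_imp_arrow)
      also have "arrow G \<dots> (expand G Z (Suc k) m g)"
        unfolding Improper expand.simps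
        using X Z by (intro sum') (auto simp: generators_def)
      finally show ?thesis
        using Improper by simp
    qed
  qed
qed

lemma arrow_flow:
  assumes "selector G Z" "a \<in> free_monoid G"
  shows "arrow G a (flow G Z N a)"
  using assms(2)
proof (induction a)
  case (add x a)
  obtain m g where x: "x = (m, g)"
    by (cases x)
  then have "arrow G (monom m g + a) (expand G Z (nat (N - m)) m g + flow G Z N a)"
    using add assms(1) by (intro arrow_add arrow_expand) auto
  then show ?case
    by (simp add: x flow_add_mset)
qed (simp add: arrow_refl)

text \<open>One pair \<open>N\<close>, \<open>Z\<close> with equal flows suffices, since both
  elements rewrite to the common flow.\<close>

lemma cong_if_eventually_flow_eq:
  assumes "eventually_flow_eq G a b" "a \<in> free_monoid G" "b \<in> free_monoid G"
  shows "cong G a b"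
proof -
  obtain N Z where Z: "selector G Z" "flow G Z N a = flow G Z N b"
    using assms(1) unfolding eventually_flow_eq_def by blast
  then have "cong G a (flow G Z N b)"
    using arrow_flow[OF Z(1) assms(2)] cong.base by metis
  moreover have "cong G (flow G Z N b) b"
    using arrow_flow[OF Z(1) assms(3)] cong.base cong.sym by metis
  ultimately show ?thesis
    by (rule cong.trans)
qed

text \<open>Flows are additive, and finite multisets cancel.\<close>

lemma cong_add_right_cancel:
  assumes "cong G (a + c) (b + c)"
  shows "cong G a b"
proof (rule cong_if_eventually_flow_eq)
  show "eventually_flow_eq G a b"
    using cong_imp_eventually_flow_eq[OF assms] unfolding eventually_flow_eq_def by simp
qed (use cong_in_free_monoid[OF assms] in auto)

lemma cong_empty_iff: "cong G {#} a \<longleftrightarrow> a = {#}"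
proof
  assume "cong G {#} a"
  then obtain N Z where "selector G Z" "flow G Z N {#} = flow G Z N a"
    using cong_imp_eventually_flow_eq unfolding eventually_flow_eq_def by blast
  then show "a = {#}"
    using flow_eq_empty_iff by (metis flow_empty)
qed (simp add: cong.refl)

lemma cong_add_self: "cong G (a + c) a \<Longrightarrow> c = {#}"
  using cong_add_right_cancel[of c a "{#}"] cong_empty_iff cong.sym
  by (metis add.commute add.left_neutral)

section \<open>The preorder and periods\<close>

lemma precsim_trans [trans]:
  assumes "precsim G a b" "precsim G b c"
  shows "precsim G a c"
proof -
  obtain d e where d: "d \<in> free_monoid G" "cong G (a + d) b"
    and e: "e \<in> free_monoid G" "cong G (b + e) c"
    using assms unfolding precsim_def by blast
  then have "cong G (a + (d + e)) c"
    using cong.trans[OF cong.add[OF d(2) e(1)] e(2)] by (simp add: add.assoc)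
  then show ?thesis
    using d e unfolding precsim_def by (metis free_monoid_plus)
qed

text \<open>Composing both inequalities makes \<open>a + (d + e)\<close> congruent to
  \<open>a\<close>, so cancellation leaves \<open>d + e\<close> congruent to zero, hence
  zero.\<close>

lemma precsim_antisym:
  assumes "precsim G a b" "precsim G b a"
  shows "cong G a b"
proof -
  obtain d e where d: "d \<in> free_monoid G" "cong G (a + d) b"
    and e: "e \<in> free_monoid G" "cong G (b + e) a"
    using assms unfolding precsim_def by blast
  then have "cong G (a + (d + e)) a"
    using cong.trans[OF cong.add[OF d(2) e(1)] e(2)] by (simp add: add.assoc)
  then have "d = {#}"
    using cong_add_self by fastforce
  then show ?thesis
    using d by simp
qed

lemma precsim_if_cong: "cong G a b \<Longrightarrow> precsim G a b"
  unfolding precsim_def by (metis add.right_neutral free_monoid_empty)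

lemma precsim_act: "precsim G a b \<Longrightarrow> precsim G (act n a) (act n b)"
  unfolding precsim_def by (metis act_in_free_monoid_iff act_plus cong.act)

lemma precsim_act_mult:
  assumes "precsim G (act n a) a" "a \<in> free_monoid G"
  shows "precsim G (act (int k * n) a) a"
proof (induction k)
  case 0
  then show ?case
    using assms by (simp add: precsim_if_cong cong.refl)
next
  case (Suc k)
  have "precsim G (act (int (Suc k) * n) a) (act n a)"
    using precsim_act[OF Suc.IH, of n] by (simp add: algebra_simps)
  then show ?case
    using assms precsim_trans by blast
qed

lemma cong_act_mult:
  assumes "cong G a (act n a)"
  shows "cong G a (act (int k * n) a)"
proof (induction k)
  case 0
  then show ?case
    using cong_in_free_monoid[OF assms] by (simp add: cong.refl)
next
  case (Suc k)
  then show ?case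
    using cong.trans[OF assms cong.act[OF Suc.IH, of n]] by (simp add: algebra_simps)
qed

text \<open>Comparability at \<open>n\<close> turns any period \<open>m\<close> into the period
  \<open>n\<close>: \<open>a\<close> is congruent to its shift by \<open>n * m\<close>, which lies
  below its shift by \<open>n\<close>, which lies below \<open>a\<close>. Antisymmetry closes the
  chain.\<close>

lemma cong_act_if_periodic:
  assumes "periodic G a" "precsim G (act n a) a" "n > 0"
  shows "cong G a (act n a)"
proof -
  obtain m where m: "m > 0" "cong G a (act m a)"
    using assms(1) unfolding periodic_def by blast
  then have a: "a \<in> free_monoid G"
    using cong_in_free_monoid by blast
  have "precsim G a (act (int (nat n) * m) a)"
    by (intro precsim_if_cong cong_act_mult m)
  \<comment> \<open>Splitting off one shift by \<open>n\<close> leaves \<open>m - 1\<close>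
    iterations of comparability under it.\<close>
  also have "act (int (nat n) * m) a = act n (act (int (nat (m - 1)) * n) a)"
    using m(1) assms(3) by (simp add: algebra_simps)
  also have "precsim G \<dots> (act n a)"
    by (intro precsim_act precsim_act_mult assms a)
  finally show ?thesis
    using assms(2) precsim_antisym by blast
qed

text \<open>A strict inequality at one \<open>n\<close> excludes every period, since any period
  would become a congruence at that same \<open>n\<close>.\<close>

lemma aperiodic_iff:
  assumes "a \<in> free_monoid G"
  shows "aperiodic G a \<longleftrightarrow> comparable G a \<and> \<not> periodic G a"
proof
  assume "aperiodic G a"
  then show "comparable G a \<and> \<not> periodic G a"
    unfolding aperiodic_def comparable_def prec_def
    using cong_act_if_periodic cong.sym by blast
next
  assume "comparable G a \<and> \<not> periodic G a"
  then show "aperiodic G a"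
    unfolding aperiodic_def comparable_def prec_def periodic_def
    using cong.sym by blast
qed

text \<open>
  If \<open>x\<^sup>n a + c \<sim> a\<close>, then \<open>x\<^sup>n a + c\<close> and \<open>a\<close> have the same flow up to some large degree \<open>N\<close>;
  the element \<open>b\<close> is the flow of \<open>a\<close> up to degree \<open>N - n\<close>.
\<close>
lemma cong_shift_imp_arrow_shift:
  assumes "cong G (act n a + c) a" "n > 0"
  obtains b d where "arrow G a b" "arrow G b (act n b + d)" "d = {#} \<longleftrightarrow> c = {#}"
proof -
  have fm: "a \<in> free_monoid G"
    using cong_in_free_monoid[OF assms(1)] by simp
  obtain N Z where Z: "selector G Z" and eq: "flow G Z N (act n a + c) = flow G Z N a"
    using cong_imp_eventually_flow_eq[OF assms(1)] unfolding eventually_flow_eq_def by blast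
  define b where "b = flow G Z (N - n) a"
  have "arrow G a b"
    unfolding b_def by (intro arrow_flow Z fm)
  moreover have "arrow G b (flow G Z N b)"
    using \<open>arrow G a b\<close> by (intro arrow_flow Z) (simp add: arrow_def)
  \<comment> \<open>The remainder \<open>d\<close> is the flow of \<open>c\<close>, which is empty
    only if \<open>c\<close> is.\<close>
  moreover have "flow G Z N b = act n b + flow G Z N c"
    using eq assms(2) by (simp add: b_def flow_flow flow_act)
  ultimately show ?thesis
    using that flow_eq_empty_iff[OF Z] by metis
qed

end

section \<open>Walks traced by monomials\<close>

fun base_vertex :: "('v, 'e) generator \<Rightarrow> 'v" where
  "base_vertex (Proper v) = v"
| "base_vertex (Improper v Z) = v"

text \<open>\<open>Improper v Z\<close> behaves like \<open>v\<close> with the arcs in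
  \<open>Z\<close> already spent. This matches \<open>cycle_contains\<close>, where a cycle has to
  leave \<open>v\<close> by an arc outside \<open>Z\<close>.\<close>

fun used_arcs :: "('v, 'e) generator \<Rightarrow> 'e set" where
  "used_arcs (Proper v) = {}"
| "used_arcs (Improper v Z) = Z"

context wf_digraph
begin

lemma monom_step_successors:
  assumes "monom_step G (m, g) r" "(m', g') \<in># r"
  shows "m' = m \<and> base_vertex g' = base_vertex g \<and> used_arcs g \<subseteq> used_arcs g' \<or>
    m' = m + 1 \<and> (\<exists>e\<in>out_arcs G (base_vertex g) - used_arcs g. g' = Proper (head G e))"
  using assms(1)
proof cases
  case (regular v)
  then show ?thesis
    using assms(2) by (auto simp: regular_vertex_def set_mset_sum)
next
  case (infinite v Z)
  then show ?thesis
    using assms(2) by (auto simp: set_mset_sum)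
next
  case (improper v W Z)
  then show ?thesis
    using assms(2) by (auto simp: set_mset_sum)
qed

text \<open>The degree rises exactly when an arc is traversed. Until then the monomial stays at its
  vertex and its set of spent arcs only grows, so the first arc traversed was not spent at the
  start.\<close>

lemma arrow_successors:
  assumes "arrow G (monom m g) d" "(m', g') \<in># d"
  shows "m' = m \<and> base_vertex g' = base_vertex g \<and> used_arcs g \<subseteq> used_arcs g' \<or>
    m' > m \<and> (\<exists>e p. e \<notin> used_arcs g \<and> awalk (base_vertex g) (e # p) (base_vertex g'))"
proof -
  have "(step G)\<^sup>*\<^sup>* (monom m g) d"
    using assms(1) by (simp add: arrow_def)
  then show ?thesis
    using assms(2)
  proof (induction arbitrary: m' g')
    case (step d d')
    obtain c x r where c: "monom_step G x r" "d = c + {#x#}" "d' = c + r"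
      using step.hyps unfolding step_iff_monom_step by blast
    obtain m1 g1 where x: "x = (m1, g1)"
      by (cases x)
    consider "(m', g') \<in># c" | "(m', g') \<in># r"
      using step.prems c by auto
    then show ?case
    proof cases
      case 1
      then show ?thesis
        using step.IH c by simp
    next
      case 2
      consider "m' = m1" "base_vertex g' = base_vertex g1" "used_arcs g1 \<subseteq> used_arcs g'"
        | f where "m' = m1 + 1" "f \<in> out_arcs G (base_vertex g1)" "f \<notin> used_arcs g1"
          "g' = Proper (head G f)"
        using monom_step_successors[OF c(1)[unfolded x] 2] by blast
      note last = this
      consider "m1 = m" "base_vertex g1 = base_vertex g" "used_arcs g \<subseteq> used_arcs g1"
        | e p where "m1 > m" "e \<notin> used_arcs g" "awalk (base_vertex g) (e # p) (base_vertex g1)"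
        using step.IH[of m1 g1] c x by auto
      then show ?thesis
      proof cases
        case 1
        note first = 1
        from last show ?thesis
        proof cases
          case 1
          then show ?thesis
            using first by simp
        next
          case (2 f)
          \<comment> \<open>The arc \<open>f\<close> is unspent at \<open>g1\<close>, hence also at
            \<open>g\<close>.\<close>
          then have "awalk (base_vertex g) [f] (base_vertex g')" "f \<notin> used_arcs g" "m' > m"
            using first by (auto simp: awalk_simps)
          then show ?thesis
            by blast
        qed
      next
        case (2 e p)
        note first = 2
        from last show ?thesis
        proof cases
          case 1
          then show ?thesis
            using first by metis
        next
          case (2 f)
          then have "awalk (base_vertex g1) [f] (base_vertex g')"
            by (auto simp: awalk_simps)
          with first(3) have "awalk (base_vertex g) ((e # p) @ [f]) (base_vertex g')"
            by (rule awalk_appendI)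
          then have "awalk (base_vertex g) (e # (p @ [f])) (base_vertex g')"
            by simp
          moreover have "m' > m"
            using 2 first by simp
          ultimately show ?thesis
            using first(2) by blast
        qed
      qed
    qed
  qed auto
qed

text \<open>The closed walk is shortened to a cycle only behind its first arc, which therefore
  remains outside \<open>used_arcs g\<close>.\<close>

lemma arrow_recurrent_imp_cycle:
  assumes "arrow G (monom m g) d" "(m', g) \<in># d" "m' > m"
  shows "\<exists>c. cycle c \<and> cycle_contains G c g"
proof -
  obtain e p where e: "e \<notin> used_arcs g" "awalk (base_vertex g) (e # p) (base_vertex g)"
    using arrow_successors[OF assms(1,2)] assms(3) by auto
  then have "awalk (head G e) p (base_vertex g)"
    unfolding awalk_Cons_iff by blast
  then have q: "apath (head G e) (awalk_to_apath p) (base_vertex g)"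
    by (rule apath_awalk_to_apath)
  then have "cycle (e # awalk_to_apath p)"
    unfolding cycle_def using e by (auto simp: apath_def awalk_Cons_iff)
  moreover have "cycle_contains G (e # awalk_to_apath p) g"
    using e by (cases g) (auto simp: awalk_Cons_iff)
  ultimately show ?thesis
    by blast
qed

section \<open>Cycles and their exits\<close>

text \<open>An infinite emitter has arcs outside the finite set of arcs of a cycle.\<close>

lemma Improper_in_cycle_has_exit:
  assumes "Improper v Z \<in> generators G" "cycle_contains G c (Improper v Z)"
  shows "has_exit G c"
proof -
  have "infinite (out_arcs G v - set c)"
    using assms(1) by (auto simp: generators_def infinite_emitter_def)
  then obtain f where "f \<in> out_arcs G v - set c"
    by (metis finite.emptyI equals0I)
  moreover have "v \<in> tail G ` set c"
    using assms(2) by auto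
  ultimately show ?thesis
    unfolding has_exit_def by blast
qed

lemma awalk_verts_eq_map_tail: "awalk u p v \<Longrightarrow> awalk_verts u p = map (tail G) p @ [v]"
  by (induction p arbitrary: u) (auto simp: awalk_simps)

lemma cycle_distinct_tails:
  assumes "cycle c"
  shows "distinct (map (tail G) c)"
proof (cases c)
  case (Cons e c')
  then obtain u where u: "awalk u c u" "distinct (tl (awalk_verts u c))"
    using assms unfolding cycle_def by blast
  then show ?thesis
    using Cons awalk_verts_eq_map_tail[OF u(1)] by (auto simp: awalk_Cons_iff)
qed simp

lemma cycle_head_in_tails:
  assumes "cycle c" "e \<in> set c"
  shows "head G e \<in> tail G ` set c"
proof -
  obtain u where u: "awalk u c u"
    using assms unfolding cycle_def by blast
  then have u_in: "u \<in> tail G ` set c"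
    using assms(2) by (cases c) (auto simp: awalk_Cons_iff)
  obtain c1 c2 where c: "c = c1 @ e # c2"
    using assms(2) by (meson split_list)
  then have w: "awalk u (c1 @ [e]) (head G e)" "awalk (head G e) c2 u"
    using u by (auto simp: awalk_simps)
  show ?thesis
  proof (cases c2)
    case Nil
    then show ?thesis
      using w u_in by (simp add: awalk_Nil_iff)
  next
    case (Cons f c3)
    then show ?thesis
      using w c by (auto simp: awalk_Cons_iff)
  qed
qed

lemma cycle_no_exit_out_arcs:
  assumes "cycle c" "\<not> has_exit G c" "v \<in> tail G ` set c"
  obtains e where "out_arcs G v = {e}" "head G e \<in> tail G ` set c"
proof -
  obtain e where e: "e \<in> set c" "tail G e = v"
    using assms(3) by auto
  have "set c \<subseteq> arcs G"
    using assms(1) unfolding cycle_def by auto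
  moreover have "f = e" if "f \<in> out_arcs G v" for f
  proof -
    have "f \<in> set c"
      using assms(2,3) that unfolding has_exit_def by blast
    then show ?thesis
      using cycle_distinct_tails[OF assms(1)] e that
      by (auto simp: distinct_map dest: inj_onD)
  qed
  ultimately have "out_arcs G v = {e}"
    using e by auto
  then show ?thesis
    using that cycle_head_in_tails[OF assms(1) e(1)] by blast
qed

lemma cycle_vertices_connected:
  assumes "cycle c" "v \<in> tail G ` set c" "w \<in> tail G ` set c"
  obtains p where "awalk v p w"
proof -
  obtain u where u: "awalk u c u"
    using assms unfolding cycle_def by blast
  obtain e f where e: "e \<in> set c" "tail G e = v" and f: "f \<in> set c" "tail G f = w"
    using assms by auto
  obtain c1 c2 where "c = c1 @ e # c2"
    using e(1) by (meson split_list)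
  then have "awalk v (e # c2) u"
    using u e by (simp add: awalk_simps)
  moreover obtain d1 d2 where "c = d1 @ f # d2"
    using f(1) by (meson split_list)
  then have "awalk u d1 w"
    using u f by (auto simp: awalk_simps)
  ultimately show ?thesis
    using that awalk_appendI by blast
qed

definition no_exit_vertices :: "'a set" where
  "no_exit_vertices = {v. \<exists>c. cycle c \<and> \<not> has_exit G c \<and> v \<in> tail G ` set c}"

lemma no_exit_vertices_out_arcs:
  assumes "v \<in> no_exit_vertices"
  obtains e where "out_arcs G v = {e}" "head G e \<in> no_exit_vertices"
proof -
  obtain c where c: "cycle c" "\<not> has_exit G c" "v \<in> tail G ` set c"
    using assms unfolding no_exit_vertices_def by blast
  then obtain e where "out_arcs G v = {e}" "head G e \<in> tail G ` set c"
    using cycle_no_exit_out_arcs by blast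
  then show ?thesis
    using that c unfolding no_exit_vertices_def by blast
qed

lemma monom_step_no_exit:
  assumes "monom_step G (m, Proper v) r" "v \<in> no_exit_vertices"
  obtains w where "w \<in> no_exit_vertices" "r = monom (m + 1) (Proper w)"
proof -
  obtain e where e: "out_arcs G v = {e}" "head G e \<in> no_exit_vertices"
    using no_exit_vertices_out_arcs assms(2) by blast
  from assms(1) show ?thesis
  proof cases
    case regular
    then show ?thesis
      using that e by simp
  next
    case infinite
    then show ?thesis
      using e by (simp add: infinite_emitter_def)
  qed
qed

text \<open>A vertex on an exitless cycle emits a single arc, so each step replaces one monomial by
  one.\<close>

lemma arrow_no_exit:
  assumes "arrow G a d" "support a \<subseteq> Proper ` no_exit_vertices"
  shows "size d = size a \<and> support d \<subseteq> Proper ` no_exit_vertices"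
proof -
  have "(step G)\<^sup>*\<^sup>* a d"
    using assms(1) by (simp add: arrow_def)
  then show ?thesis
  proof induction
    case (step d d')
    obtain c x r where c: "monom_step G x r" "d = c + {#x#}" "d' = c + r"
      using step.hyps unfolding step_iff_monom_step by blast
    then obtain m v where "x = (m, Proper v)" "v \<in> no_exit_vertices"
      using step.IH by (cases x) (auto simp: support_def)
    then obtain w where "w \<in> no_exit_vertices" "r = monom (m + 1) (Proper w)"
      using c(1) monom_step_no_exit by blast
    then show ?case
      using step.IH c by (auto simp: support_def)
  qed (use assms(2) in simp)
qed

section \<open>Growth forces an exit\<close>

lemma arrow_source:
  assumes "arrow G a d" "y \<in># d"
  shows "\<exists>x\<in>#a. \<exists>d'. arrow G {#x#} d' \<and> y \<in># d'"
  using assms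
proof (induction a arbitrary: d)
  case empty
  then show ?case
    using arrow_from_empty by fastforce
next
  case (add x a)
  then have "arrow G ({#x#} + a) d"
    by simp
  then obtain d1 d2 where "d = d1 + d2" "arrow G {#x#} d1" "arrow G a d2"
    using arrow_split by blast
  then show ?case
    using add by auto
qed

text \<open>The shift \<open>k\<close> must be positive for a monomial related to itself to have
  traversed an arc, and hence to lie on a cycle.\<close>

definition recurs_to :: "int \<times> ('a, 'b) generator \<Rightarrow> int \<times> ('a, 'b) generator \<Rightarrow> bool" where
  "recurs_to x y \<longleftrightarrow> (\<exists>k>0. \<exists>d. arrow G {#x#} d \<and> act k {#y#} \<subseteq># d)"

text \<open>The shifted copy of \<open>y\<close> inside \<open>d\<close> is rewritten by the
  derivation from \<open>y\<close>, shifted by \<open>k\<close>.\<close>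

lemma recurs_to_trans:
  assumes "recurs_to x y" "recurs_to y z"
  shows "recurs_to x z"
proof -
  obtain k d k' d' where d: "k > 0" "arrow G {#x#} d" "act k {#y#} \<subseteq># d"
    and d': "k' > 0" "arrow G {#y#} d'" "act k' {#z#} \<subseteq># d'"
    using assms unfolding recurs_to_def by blast
  obtain c where c: "d = act k {#y#} + c"
    using d(3) by (metis subset_mset.le_iff_add)
  have "arrow G d (act k d' + c)"
    unfolding c using d(2) c by (intro arrow_add_right arrow_act d') (simp add: arrow_def)
  with d(2) have "arrow G {#x#} (act k d' + c)"
    by (rule arrow_trans)
  moreover obtain c' where "d' = act k' {#z#} + c'"
    using d'(3) by (metis subset_mset.le_iff_add)
  then have "act (k + k') {#z#} \<subseteq># act k d' + c"
    by simp
  moreover have "k + k' > 0"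
    using d(1) d'(1) by simp
  ultimately show ?thesis
    unfolding recurs_to_def by blast
qed

lemma recurs_to_self_imp_cycle:
  assumes "recurs_to (m, g) (m, g)"
  shows "\<exists>c. cycle c \<and> cycle_contains G c g"
proof -
  obtain k d where "k > 0" "arrow G (monom m g) d" "(k + m, g) \<in># d"
    using assms unfolding recurs_to_def by auto
  then show ?thesis
    using arrow_recurrent_imp_cycle[of m g d "k + m"] by simp
qed

text \<open>
  The part \<open>a'\<close> of \<open>a\<close> that lies on no cycle reproduces its own shift; since the successor relation
  on its finitely many monomials has no loops, \<open>a'\<close> vanishes. The rest of \<open>a\<close> moves along
  exitless cycles, so the number of monomials is constant.
\<close>
lemma exit_if_growing:
  assumes "arrow G a (act n a + d)" "n > 0" "d \<noteq> {#}"
  shows "\<exists>c\<in>core_cycles G a. has_exit G c"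
proof (rule ccontr)
  assume no_exit: "\<not> (\<exists>c\<in>core_cycles G a. has_exit G c)"
  define ac where "ac = filter_mset (\<lambda>x. snd x \<in> Proper ` no_exit_vertices) a"
  define a' where "a' = filter_mset (\<lambda>x. snd x \<notin> Proper ` no_exit_vertices) a"
  have a: "a = ac + a'"
    unfolding ac_def a'_def by (rule multiset_partition)
  \<comment> \<open>Such a cycle would be a core cycle, hence exitless. That puts a proper
    \<open>g\<close> on an exitless cycle, while an improper \<open>g\<close> would supply an
    exit.\<close>
  have no_cycle: "\<not> (\<exists>c. cycle c \<and> cycle_contains G c g)" if "(m, g) \<in># a'" for m g
  proof
    assume "\<exists>c. cycle c \<and> cycle_contains G c g"
    then obtain c where c: "cycle c" "cycle_contains G c g"
      by blast
    have g: "(m, g) \<in># a" "g \<notin> Proper ` no_exit_vertices"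
      using that by (auto simp: a'_def)
    then have "c \<in> core_cycles G a"
      using c by (force simp: core_cycles_def support_def)
    then have ne: "\<not> has_exit G c"
      using no_exit by blast
    have "g \<in> generators G"
      using g(1) assms(1) by (force simp: arrow_def free_monoid_def)
    then show False
      using g(2) c ne Improper_in_cycle_has_exit
      by (cases g) (auto simp: no_exit_vertices_def)
  qed
  obtain dc d' where split: "act n a + d = dc + d'" "arrow G ac dc" "arrow G a' d'"
    using arrow_split assms(1) a by metis
  have dc: "size dc = size ac" "support dc \<subseteq> Proper ` no_exit_vertices"
    using arrow_no_exit[OF split(2)] by (auto simp: ac_def support_def)
  have "a' = {#}"
  proof (rule ccontr)
    assume "a' \<noteq> {#}"
    have irrefl: "\<not> recurs_to x x" if "x \<in># a'" for x
      using no_cycle recurs_to_self_imp_cycle that by (cases x) blast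
    have "asymp_on (set_mset a') recurs_to"
      using irrefl recurs_to_trans by (intro asymp_onI) metis
    moreover have "transp_on (set_mset a') recurs_to"
      using recurs_to_trans by (intro transp_onI)
    ultimately obtain y where y: "y \<in># a'" "\<forall>x\<in>#a'. x \<noteq> y \<longrightarrow> \<not> recurs_to x y"
      using Finite_Set.bex_min_element[of "set_mset a'" recurs_to] \<open>a' \<noteq> {#}\<close> by auto
    obtain m g where mg: "y = (m, g)"
      by (cases y)
    have "(n + m, g) \<in># act n a"
      using y(1) mg by (force simp: a'_def act_def)
    then have "(n + m, g) \<in># dc + d'"
      using split(1) by (metis union_iff)
    \<comment> \<open>\<open>dc\<close> stays on exitless cycles, so the shifted copy of the minimal
      \<open>y\<close> descends from a monomial of \<open>a'\<close>.\<close>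
    moreover have "(n + m, g) \<notin># dc"
      using dc(2) y(1) mg by (force simp: a'_def support_def)
    ultimately have "(n + m, g) \<in># d'"
      by simp
    then obtain x d'' where "x \<in># a'" "arrow G {#x#} d''" "(n + m, g) \<in># d''"
      using arrow_source[OF split(3)] by blast
    then have "x \<in># a'" "recurs_to x y"
      using assms(2) mg unfolding recurs_to_def by auto
    then show False
      using y irrefl by metis
  qed
  then have "a' = {#}" "d' = {#}"
    using split(3) arrow_from_empty by auto
  then have "size (act n a + d) = size a"
    using split(1) dc(1) a by simp
  then show False
    using assms(3) by simp
qed

section \<open>Monomials that move without multiplying\<close>

definition travels_far :: "int \<Rightarrow> ('a, 'b) generator \<Rightarrow> bool" where
  "travels_far m g \<longleftrightarrow> (\<forall>k. \<exists>m'\<ge>k. \<exists>g'. arrow G (monom m g) (monom m' g'))"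

text \<open>A step at an infinite emitter produces an improper vertex and at least one further
  monomial. Only a regular vertex with one arc yields a single monomial.\<close>

lemma monom_step_singleton:
  assumes "monom_step G (m, g) r" "size r \<le> 1"
  obtains v e where "g = Proper v" "out_arcs G v = {e}" "r = monom (m + 1) (Proper (head G e))"
  using assms(1)
proof cases
  case (regular v)
  then have "card (out_arcs G v) = 1"
    using assms(2) size_monom_step[OF assms(1)] by (simp add: regular_vertex_def size_sum_monom)
  then obtain e where "out_arcs G v = {e}"
    by (auto simp: card_1_singleton_iff)
  then show ?thesis
    using that regular by simp
next
  case (infinite v Z)
  then show ?thesis
    using assms(2) by (simp add: size_sum_monom)
next
  case (improper v W Z)
  then have "card (W - Z) = 0"
    using assms(2) by (simp add: size_sum_monom)
  then show ?thesis
    using improper by (auto simp: card_eq_0_iff)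
qed

lemma arrow_singleton:
  assumes "arrow G (monom m g) (monom m' g')" "m < m'"
  obtains v e where "g = Proper v" "out_arcs G v = {e}"
    "arrow G (monom (m + 1) (Proper (head G e))) (monom m' g')"
proof -
  have "(step G)\<^sup>*\<^sup>* (monom m g) (monom m' g')" "monom m g \<noteq> monom m' g'"
    using assms by (auto simp: arrow_def)
  then obtain r where r: "step G (monom m g) r" "(step G)\<^sup>*\<^sup>* r (monom m' g')"
    by (metis converse_rtranclpE)
  obtain c x r' where "monom m g = c + {#x#}" "monom_step G x r'" "r = c + r'"
    using r(1) unfolding step_iff_monom_step by blast
  then have "monom_step G (m, g) r"
    by (auto simp: single_is_union)
  \<comment> \<open>Sizes never shrink, so a derivation ending in one monomial cannot branch
    earlier.\<close>
  moreover have "size r \<le> 1"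
    using size_steps[OF r(2)] by simp
  ultimately obtain v e where "g = Proper v" "out_arcs G v = {e}"
    "r = monom (m + 1) (Proper (head G e))"
    using monom_step_singleton by blast
  moreover have "arrow G r (monom m' g')"
    using r assms(1) step_in_free_monoid[OF r(1)] by (simp add: arrow_def)
  ultimately show ?thesis
    using that by simp
qed

lemma travels_far_next:
  assumes "travels_far m g"
  obtains v e where "g = Proper v" "out_arcs G v = {e}" "travels_far (m + 1) (Proper (head G e))"
proof -
  have *: "\<exists>v e. g = Proper v \<and> out_arcs G v = {e} \<and>
    (\<exists>m'\<ge>k. \<exists>g'. arrow G (monom (m + 1) (Proper (head G e))) (monom m' g'))" for k
  proof -
    \<comment> \<open>The bound \<open>m + 1\<close> makes the arrow nontrivial, so it has a first
      step.\<close>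
    obtain m' g' where m': "m' \<ge> max k (m + 1)" "arrow G (monom m g) (monom m' g')"
      using assms unfolding travels_far_def by blast
    then have "m < m'" "k \<le> m'"
      by simp_all
    from m'(2) this(1) obtain v e where "g = Proper v" "out_arcs G v = {e}"
      "arrow G (monom (m + 1) (Proper (head G e))) (monom m' g')"
      by (rule arrow_singleton)
    then show ?thesis
      using \<open>k \<le> m'\<close> by blast
  qed
  then obtain v e where ve: "g = Proper v" "out_arcs G v = {e}"
    by blast
  \<comment> \<open>The arc \<open>e\<close> is the same for all \<open>k\<close>, being the only
    one emitted by \<open>v\<close>.\<close>
  have "travels_far (m + 1) (Proper (head G e))"
    unfolding travels_far_def using * ve by fastforce
  then show ?thesis
    using that ve by blast
qed

text \<open>The moving monomial has only one arc to follow at each vertex, so it follows the given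
  walk.\<close>

lemma travels_far_awalk: "awalk u p w \<Longrightarrow> travels_far m (Proper u) \<Longrightarrow> \<exists>m'. travels_far m' (Proper w)"
proof (induction p arbitrary: u m)
  case (Cons e p)
  then have e: "e \<in> out_arcs G u" "awalk (head G e) p w"
    by (auto simp: awalk_Cons_iff)
  obtain f where "out_arcs G u = {f}" "travels_far (m + 1) (Proper (head G f))"
    using travels_far_next[OF Cons.prems(2)] by auto
  then show ?case
    using e Cons.IH by auto
qed (auto simp: awalk_Nil_iff)

text \<open>Iterating the arrow raises all degrees without bound at constant size. As no monomial
  can vanish, each is carried to exactly one monomial.\<close>

lemma arrow_act_imp_travels_far:
  assumes "arrow G a (act n a)" "n > 0" "(m, g) \<in># a"
  shows "travels_far m g"
  unfolding travels_far_def
proof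
  fix k
  define l where "l = Min (fst ` set_mset a)"
  have l: "l \<le> m'" if "(m', g') \<in># a" for m' g'
    unfolding l_def using that by (force intro: Min_le)
  \<comment> \<open>Each shift raises degrees by at least one, so \<open>j\<close> shifts lift even
    the least degree \<open>l\<close> of \<open>a\<close> to at least \<open>k\<close>.\<close>
  define j where "j = nat (k - l)"
  have "arrow G a (act (int i * n) a)" for i
  proof (induction i)
    case 0
    then show ?case
      using assms(1) by (simp add: arrow_def)
  next
    case (Suc i)
    then show ?case
      using arrow_trans[OF assms(1) arrow_act[OF Suc, of n]] by (simp add: algebra_simps)
  qed
  then have "arrow G a (act (int j * n) a)" .
  moreover obtain a' where a': "a = monom m g + a'"
    using assms(3) by (metis insert_DiffM add_mset_add_single add.commute)
  ultimately obtain d d' where d: "act (int j * n) a = d + d'" "arrow G (monom m g) d"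
    "arrow G a' d'"
    using arrow_split by metis
  have "size d + size d' = size a' + 1"
    using arg_cong[OF d(1), of size] a' by simp
  moreover have "1 \<le> size d" "size a' \<le> size d'"
    using size_arrow[OF d(2)] size_arrow[OF d(3)] by simp_all
  ultimately have "size d = 1"
    by linarith
  then obtain m' g' where d1: "d = monom m' g'"
    by (metis size_1_singleton_mset surj_pair)
  then have "(m', g') \<in># act (int j * n) a"
    using d(1) by simp
  then obtain m1 where "m' = int j * n + m1" "(m1, g') \<in># a"
    by (auto simp: act_def)
  moreover have "int j \<le> int j * n"
    using assms(2) by (simp add: mult_le_cancel_left1)
  ultimately have "k \<le> m'"
    using l[of m1 g'] unfolding j_def by linarith
  then show "\<exists>m'\<ge>k. \<exists>g'. arrow G (monom m g) (monom m' g')"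
    using d(2) d1 by blast
qed

text \<open>An exit gives some vertex of the cycle two arcs, yet that vertex is reached from a
  monomial of \<open>a\<close>, which meets only vertices emitting one arc.\<close>

lemma no_exit_if_arrow_act:
  assumes "arrow G a (act n a)" "n > 0" "c \<in> core_cycles G a"
  shows "\<not> has_exit G c"
proof
  assume "has_exit G c"
  then obtain w f where f: "w \<in> tail G ` set c" "f \<in> out_arcs G w" "f \<notin> set c"
    unfolding has_exit_def by blast
  obtain m g where g: "(m, g) \<in># a" "cycle_contains G c g" and c: "cycle c"
    using assms(3) by (auto simp: core_cycles_def support_def)
  have far: "travels_far m g"
    using arrow_act_imp_travels_far assms g by blast
  then obtain v where v: "g = Proper v"
    by (rule travels_far_next)
  then have "v \<in> tail G ` set c"
    using g by simp
  then obtain p where "awalk v p w"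
    using cycle_vertices_connected[OF c _ f(1)] by blast
  then obtain m' where "travels_far m' (Proper w)"
    using travels_far_awalk far v by blast
  then obtain e where "out_arcs G w = {e}"
    by (rule travels_far_next) auto
  moreover obtain e' where "e' \<in> set c" "tail G e' = w"
    using f(1) by auto
  moreover have "set c \<subseteq> arcs G"
    using c unfolding cycle_def by auto
  ultimately show False
    using f(2,3) by (metis in_out_arcs_conv singletonD subsetD)
qed

end

theorem theorem5p4:
  fixes E :: "('v, 'e) pre_digraph" and a :: "('v, 'e) elt"
  assumes "wf_digraph E"
    and "a \<in> free_monoid E"
  shows "(aperiodic E a \<longleftrightarrow> comparable E a \<and> \<not> periodic E a) \<and>
         (comparable E a \<and> \<not> periodic E a \<longleftrightarrow>
            (\<exists>b. stationary E b \<and> arrow E a b \<and> (\<exists>c \<in> core_cycles E b. has_exit E c)))"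
proof -
  interpret wf_digraph E
    by fact
  have "\<exists>b. stationary E b \<and> arrow E a b \<and> (\<exists>c \<in> core_cycles E b. has_exit E c)"
    if comp: "comparable E a" and per: "\<not> periodic E a"
  proof -
    obtain n c where n: "n > 0" "cong E (act n a + c) a"
      using comp unfolding comparable_def precsim_def by blast
    \<comment> \<open>Otherwise \<open>n\<close> would be a period of \<open>a\<close>.\<close>
    have "c \<noteq> {#}"
      using per n cong.sym unfolding periodic_def by force
    then obtain b d where b: "arrow E a b" "arrow E b (act n b + d)" "d \<noteq> {#}"
      using cong_shift_imp_arrow_shift[OF n(2,1)] by metis
    have exit: "\<exists>c\<in>core_cycles E b. has_exit E c"
      by (rule exit_if_growing[OF b(2) n(1) b(3)])
    then have "b \<noteq> {#}"
      by (auto simp: core_cycles_def support_def)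
    then have "stationary E b"
      using b n(1) unfolding stationary_def by (auto simp: arrow_def)
    then show ?thesis
      using b(1) exit by blast
  qed
  moreover have "comparable E a \<and> \<not> periodic E a"
    if st: "stationary E b" and ab': "arrow E a b" and c: "c \<in> core_cycles E b" "has_exit E c" for b c
  proof -
    obtain n d where n: "n > 0" and d: "d \<in> free_monoid E" "arrow E b (act n b + d)"
      using st unfolding stationary_def by blast
    have ab: "cong E a b"
      using ab' by (rule cong.base)
    have b: "cong E (act n b + d) b"
      using d(2) by (intro cong.sym[OF cong.base])
    then have prec: "precsim E (act n b) b"
      using d(1) unfolding precsim_def by blast
    have "precsim E (act n a) a"
      by (rule precsim_trans[OF precsim_if_cong[OF cong.act[OF ab]]
            precsim_trans[OF prec precsim_if_cong[OF cong.sym[OF ab]]]])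
    then have "comparable E a"
      using n unfolding comparable_def by blast
    moreover have "\<not> periodic E a"
    proof
      assume "periodic E a"
      then have "periodic E b"
        unfolding periodic_def using ab cong.act cong.sym cong.trans by metis
      \<comment> \<open>Any period of \<open>b\<close> becomes the period \<open>n\<close> of the
        stationary relation, so that \<open>d\<close> cancels and exits are excluded.\<close>
      then have "cong E (act n b + d) (act n b)"
        using cong_act_if_periodic[OF _ prec n] b cong.trans by blast
      then have "d = {#}"
        by (rule cong_add_self)
      then show False
        using no_exit_if_arrow_act[of b n c] d n c by simp
    qed
    ultimately show ?thesis
      by blast
  qed
  ultimately show ?thesis
    using aperiodic_iff[OF assms(2)] by blast
qed

end
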